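(* Let $G$ be a connected graph with $\mathrm{vol}(G)\ge 6$, and let $G'$ be obtained from $G$ by adding one edge $\{a,b\}$ with $a\ne b$ non-adjacent in $G$. Let $H$ be a connected graph with diameter $D_H$ and $|V(H)|=k\ge 2$. Then $$\frac{\lambda(G',H)}{\lambda(G,H)}\le \left(1+\frac{2}{\mathrm{vol}(G)}\right)(1+D_H^2)$$ and $$\frac{\lambda(G',H)}{\lambda(G,H)}\ge \left(1+\frac{2}{\mathrm{vol}(G)}\right)\max\left\{\frac{\mathrm{vol}(G)-1}{\mathrm{vol}(G)-1+D_H^2(2\,\mathrm{vol}(G)+1)},\ \frac14\right\}.$$
   Context: All graphs are finite and simple. For a graph $G$, $d_v$ denotes the degree of $v$, $u\sim v$ means adjacency, and $\mathrm{vol}(G)=\sum_v d_v$. For a metric space $(X,d)$ and $f:V(G)\to X$ set $R_f(G,X)=\frac{\mathrm{vol}(G)\sum_{u\sim v} d(f(u),f(v))^2}{\sum_{u,v} d(f(u),f(v))^2 d_u d_v}$, where the numerator sum is over edges of $G$ and the denominator sum over unordered pairs of vertices; $\lambda(G,X)=\inf_f R_f(G,X)$ over all $f$ with nonzero denominator. A connected graph $H$ is regarded as the metric space $(V(H),d_H)$ with shortest-path distance, and $\lambda(G,H)=\lambda(G,(V(H),d_H))$. *)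

theory Defs
  imports
    "HOL-Analysis.Abstract_Metric_Spaces"
    "Graph_Theory.Graph_Theory"
begin

text \<open>
  A finite simple graph is a \<open>pair_graph\<close>: every edge is represented by two
  arcs of opposite direction. Hence the degree of a vertex is its out-degree.
\<close>

definition vol :: "'a pair_pre_digraph \<Rightarrow> nat" where
  "vol G = (\<Sum>v\<in>pverts G. out_degree (with_proj G) v)"

definition add_edge :: "'a pair_pre_digraph \<Rightarrow> 'a \<Rightarrow> 'a \<Rightarrow> 'a pair_pre_digraph" where
  "add_edge G a b = \<lparr>pverts = pverts G, parcs = parcs G \<union> {(a, b), (b, a)}\<rparr>"

definition graph_dist :: "'a pair_pre_digraph \<Rightarrow> 'a \<Rightarrow> 'a \<Rightarrow> real" where
  "graph_dist G u v = real_of_ereal (wf_digraph.\<mu> (with_proj G) (\<lambda>_. 1) u v)"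

definition graph_diameter :: "'a pair_pre_digraph \<Rightarrow> real" where
  "graph_diameter G = Max {graph_dist G u v | u v. u \<in> pverts G \<and> v \<in> pverts G}"

text \<open>
  The halves turn the sums over arcs and over ordered pairs into sums over edges
  and over unordered pairs; \<open>d\<close> is symmetric, and pairs with equal entries contribute 0.
\<close>

definition edge_sum :: "'a pair_pre_digraph \<Rightarrow> ('b \<Rightarrow> 'b \<Rightarrow> real) \<Rightarrow> ('a \<Rightarrow> 'b) \<Rightarrow> real" where
  "edge_sum G d f = (\<Sum>(u, v)\<in>parcs G. (d (f u) (f v))\<^sup>2) / 2"

definition pair_sum :: "'a pair_pre_digraph \<Rightarrow> ('b \<Rightarrow> 'b \<Rightarrow> real) \<Rightarrow> ('a \<Rightarrow> 'b) \<Rightarrow> real" where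
  "pair_sum G d f =
    (\<Sum>u\<in>pverts G. \<Sum>v\<in>pverts G. (d (f u) (f v))\<^sup>2
       * real (out_degree (with_proj G) u) * real (out_degree (with_proj G) v)) / 2"

definition rayleigh :: "'a pair_pre_digraph \<Rightarrow> ('b \<Rightarrow> 'b \<Rightarrow> real) \<Rightarrow> ('a \<Rightarrow> 'b) \<Rightarrow> real" where
  "rayleigh G d f = real (vol G) * edge_sum G d f / pair_sum G d f"

definition spectral_gap :: "'a pair_pre_digraph \<Rightarrow> 'b set \<Rightarrow> ('b \<Rightarrow> 'b \<Rightarrow> real) \<Rightarrow> real" where
  "spectral_gap G X d =
    Inf {rayleigh G d f | f. f \<in> pverts G \<rightarrow> X \<and> pair_sum G d f \<noteq> 0}"

definition graph_spectral_gap :: "'a pair_pre_digraph \<Rightarrow> 'b pair_pre_digraph \<Rightarrow> real" where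
  "graph_spectral_gap G H = spectral_gap G (pverts H) (graph_dist H)"

lemma Metric_space_graph_dist:
  assumes "pair_graph G" and "Digraph_Component.connected (with_proj G)"
  shows "Metric_space (pverts G) (graph_dist G)"
proof -
  interpret pair_graph G by fact
  have cost: "awalk_cost (\<lambda>_. 1) p = real (length p)" for p :: "('a \<times> 'a) list"
    by (induction p) (auto simp: awalk_cost_def)
  have sc: "Digraph_Component.strongly_connected (with_proj G)"
    using assms(2) symmetric_connected_imp_strongly_connected pair_sym_arcs by blast
  have attained: "\<exists>p. awalk u p v \<and> graph_dist G u v = real (length p)"
    if uv: "u \<in> pverts G" "v \<in> pverts G" for u v
  proof -
    have "u \<rightarrow>\<^sup>*\<^bsub>with_proj G\<^esub> v"
      using sc uv by (auto simp: Digraph_Component.strongly_connected_def)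
    from min_cost_awalk[OF this, of "\<lambda>_. 1"] obtain p where
      "apath u p v" "\<mu> (\<lambda>_. 1) u v = awalk_cost (\<lambda>_. 1) p" by auto
    then show ?thesis by (auto simp: graph_dist_def apath_def cost)
  qed
  have least: "graph_dist G u v \<le> real (length p)" if w: "awalk u p v" for u v p
  proof -
    have "\<mu> (\<lambda>_. 1) u v \<le> ereal (real (length p))"
      using min_cost_le_walk_cost[OF w, of "\<lambda>_. 1"] by (simp add: cost)
    moreover have "\<mu> (\<lambda>_. 1) u v \<ge> 0"
      unfolding \<mu>_def by (rule INF_greatest) (simp add: cost)
    ultimately show ?thesis
      unfolding graph_dist_def by (cases "\<mu> (\<lambda>_. 1) u v") auto
  qed
  have nonneg: "0 \<le> graph_dist G u v" for u v
    unfolding graph_dist_def \<mu>_def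
    by (rule real_of_ereal_pos, rule INF_greatest) (simp add: cost)
  have half: "graph_dist G u v \<le> graph_dist G v u" if uv: "u \<in> pverts G" "v \<in> pverts G" for u v
  proof -
    obtain p where p: "awalk v p u" "graph_dist G v u = real (length p)"
      using attained uv by blast
    have "length (rev_path p) = length p" by (induction p) auto
    with least[of u "rev_path p" v] p show ?thesis by simp
  qed
  show ?thesis
  proof
    fix x y z
    show "0 \<le> graph_dist G x y" by (rule nonneg)
    show "graph_dist G x y = graph_dist G y x"
    proof (cases "x \<in> pverts G \<and> y \<in> pverts G")
      case True
      then show ?thesis using half by (meson antisym)
    next
      case False
      then have "{p. awalk x p y} = {}" "{p. awalk y p x} = {}"
        using awalk_hd_in_verts awalk_last_in_verts by auto
      then show ?thesis unfolding graph_dist_def \<mu>_def by simp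
    qed
    assume x: "x \<in> pverts G" and y: "y \<in> pverts G"
    show "graph_dist G x y = 0 \<longleftrightarrow> x = y"
    proof
      assume "graph_dist G x y = 0"
      with attained[OF x y] show "x = y" by (auto simp: awalk_Nil_iff)
    next
      assume "x = y"
      with least[of x "[]" y] x nonneg[of x y] show "graph_dist G x y = 0"
        by (auto simp: awalk_Nil_iff)
    qed
    assume z: "z \<in> pverts G"
    obtain p q where "awalk x p y" "graph_dist G x y = real (length p)"
      "awalk y q z" "graph_dist G y z = real (length q)"
      using attained x y z by meson
    then show "graph_dist G x z \<le> graph_dist G x y + graph_dist G y z"
      using least[of x "p @ q" z] by auto
  qed
qed

end

theory Submission
  imports Defs
begin

text \<open>
  Write \<open>\<delta> = d(f(a), f(b))\<^sup>2\<close> and \<open>S(x) = \<Sum>\<^sub>v d(f(x), f(v))\<^sup>2 d\<^sub>v\<close>. Adding the edge \<open>{a, b}\<close> raises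
  the edge sum \<open>E\<close> by \<open>\<delta>\<close> and the pair sum \<open>P\<close> by \<open>S(a) + S(b) + \<delta>\<close>.
  For non-constant \<open>f\<close> some edge of \<open>G\<close> is stretched, so \<open>E \<ge> 1\<close> and \<open>E + \<delta> \<le> (1 + D\<^sub>H\<^sup>2) E\<close>;
  this gives the upper bound. For the lower bound it suffices to bound the growth of \<open>P\<close>. As all
  degrees are at least 1, each of \<open>S(a)\<close>, \<open>S(b)\<close>, \<open>\<delta>\<close> is at most \<open>P\<close>, so the new pair sum is at
  most \<open>4 P\<close>. On the other hand the increment is at most \<open>D\<^sub>H\<^sup>2 (2 vol(G) + 1)\<close>, while the fibre of
  \<open>f\<close> through a point, of volume \<open>x\<close>, gives \<open>P \<ge> x (vol(G) - x) \<ge> vol(G) - 1\<close>.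
\<close>

section \<open>Weighted double sums of a symmetric kernel\<close>

lemma sum_mult_of_bool_eq:
  fixes h :: "'a \<Rightarrow> real"
  assumes "finite A" "a \<in> A"
  shows "(\<Sum>v\<in>A. h v * of_bool (v = a)) = h a"
  using assms by (simp add: of_bool_def if_distrib cong: if_cong)

text \<open>Expanding the product gives four sums. The two mixed ones agree by symmetry of
  \<open>g\<close>, and the last one reduces to \<open>g a a = 0\<close>. Applied once for each
  endpoint of the new edge.\<close>

lemma weighted_pair_sum_add_point:
  fixes g :: "'a \<Rightarrow> 'a \<Rightarrow> real"
  assumes "finite A" "a \<in> A" "\<And>u v. g u v = g v u" "g a a = 0"
  shows "(\<Sum>u\<in>A. \<Sum>v\<in>A. g u v * (w u + of_bool (u = a)) * (w v + of_bool (v = a)))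
    = (\<Sum>u\<in>A. \<Sum>v\<in>A. g u v * w u * w v) + 2 * (\<Sum>v\<in>A. g a v * w v)"
proof -
  have "(\<Sum>u\<in>A. \<Sum>v\<in>A. g u v * (w u + of_bool (u = a)) * (w v + of_bool (v = a)))
    = (\<Sum>u\<in>A. \<Sum>v\<in>A. g u v * w u * w v) + (\<Sum>u\<in>A. \<Sum>v\<in>A. (g u v * w u) * of_bool (v = a))
      + (\<Sum>u\<in>A. (\<Sum>v\<in>A. g u v * w v) * of_bool (u = a))
      + (\<Sum>u\<in>A. (\<Sum>v\<in>A. g u v * of_bool (v = a)) * of_bool (u = a))"
    unfolding sum_distrib_right sum.distrib[symmetric]
    by (intro sum.cong refl) (simp add: algebra_simps)
  moreover have "(\<Sum>u\<in>A. g u a * w u) = (\<Sum>v\<in>A. g a v * w v)"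
    by (rule sum.cong) (simp_all add: assms(3)[of a])
  ultimately show ?thesis
    using assms(4) by (simp add: sum_mult_of_bool_eq[OF assms(1,2)])
qed

text \<open>Row \<open>a\<close> and column \<open>a\<close> of the matrix of summands overlap only
  in the diagonal entry, which vanishes. Since \<open>1 \<le> w a\<close>, each of them contributes
  at least the sum on the left.\<close>

lemma row_sum_le_weighted_pair_sum:
  fixes g :: "'a \<Rightarrow> 'a \<Rightarrow> real"
  assumes "finite A" "a \<in> A" "\<And>u v. g u v = g v u" "\<And>u v. 0 \<le> g u v" "g a a = 0"
    and w: "\<And>u. u \<in> A \<Longrightarrow> 0 \<le> w u" "1 \<le> w a"
  shows "2 * (\<Sum>v\<in>A. g a v * w v) \<le> (\<Sum>u\<in>A. \<Sum>v\<in>A. g u v * w u * w v)"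
proof -
  have row: "(\<Sum>v\<in>A. g a v * w v) \<le> (\<Sum>v\<in>A. g a v * w a * w v)"
  proof (rule sum_mono)
    fix v assume "v \<in> A"
    then have "g a v * w v * 1 \<le> g a v * w v * w a"
      using assms by (intro mult_left_mono) auto
    then show "g a v * w v \<le> g a v * w a * w v" by (simp add: mult_ac)
  qed
  have "(\<Sum>v\<in>A. g a v * w a * w v) = (\<Sum>v\<in>A - {a}. g a v * w a * w v)"
    using assms(5) by (simp add: sum.remove[OF assms(1,2)])
  also have "\<dots> = (\<Sum>u\<in>A - {a}. g u a * w u * w a)"
    by (rule sum.cong) (simp_all add: assms(3))
  also have "\<dots> \<le> (\<Sum>u\<in>A - {a}. \<Sum>v\<in>A. g u v * w u * w v)"
  proof (rule sum_mono)
    fix u assume "u \<in> A - {a}"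
    then have "0 \<le> g u v * w u * w v" if "v \<in> A" for v
      using that w(1) assms(4) by simp
    then show "g u a * w u * w a \<le> (\<Sum>v\<in>A. g u v * w u * w v)"
      using assms(1,2) by (intro member_le_sum[of a A "\<lambda>v. g u v * w u * w v"]) auto
  qed
  finally have "(\<Sum>v\<in>A. g a v * w a * w v) + (\<Sum>v\<in>A. g a v * w a * w v)
      \<le> (\<Sum>u\<in>A. \<Sum>v\<in>A. g u v * w u * w v)"
    by (simp add: sum.remove[OF assms(1,2), of "\<lambda>u. \<Sum>v\<in>A. g u v * w u * w v"])
  with row show ?thesis by linarith
qed

text \<open>Only pairs with one entry in the fibre of \<open>f\<close> through \<open>p\<close> and
  the other outside it are counted. Both sides have mass at least 1, because \<open>p\<close> lies
  inside and \<open>q\<close> outside.\<close>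

lemma weighted_pair_sum_ge:
  fixes g :: "'a \<Rightarrow> 'a \<Rightarrow> real"
  assumes "finite A" "p \<in> A" "q \<in> A" "f p \<noteq> f q"
    and g: "\<And>u v. 0 \<le> g u v" "\<And>u v. u \<in> A \<Longrightarrow> v \<in> A \<Longrightarrow> f u \<noteq> f v \<Longrightarrow> 1 \<le> g u v"
    and w: "\<And>u. u \<in> A \<Longrightarrow> 1 \<le> w u"
  shows "2 * (sum w A - 1) \<le> (\<Sum>u\<in>A. \<Sum>v\<in>A. g u v * w u * w v)"
proof -
  define \<beta> where "\<beta> u = of_bool (f u = f p) * w u" for u
  define \<gamma> where "\<gamma> u = of_bool (f u \<noteq> f p) * w u" for u
  have w0: "0 \<le> w u" if "u \<in> A" for u using w[OF that] by simp
  have total: "sum w A = sum \<beta> A + sum \<gamma> A"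
    unfolding sum.distrib[symmetric] by (rule sum.cong) (auto simp: \<beta>_def \<gamma>_def)
  have "\<beta> p \<le> sum \<beta> A" "\<gamma> q \<le> sum \<gamma> A"
    using assms(1-4) w0 by (auto intro!: member_le_sum simp: \<beta>_def \<gamma>_def)
  then have "1 \<le> sum \<beta> A" "1 \<le> sum \<gamma> A"
    using assms(2-4) w[of p] w[of q] by (auto simp: \<beta>_def \<gamma>_def)
  \<comment> \<open>Expanded, this bounds the product of the two masses below by their sum minus 1,
    that is, by the total weight minus 1.\<close>
  then have "0 \<le> (sum \<beta> A - 1) * (sum \<gamma> A - 1)" by simp
  then have "2 * (sum w A - 1) \<le> 2 * (sum \<beta> A * sum \<gamma> A)"
    by (simp add: total algebra_simps)
  also have "\<dots> = sum \<beta> A * sum \<gamma> A + sum \<gamma> A * sum \<beta> A" by simp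
  also have "\<dots> = (\<Sum>u\<in>A. \<Sum>v\<in>A. \<beta> u * \<gamma> v + \<gamma> u * \<beta> v)"
    by (simp only: sum_product sum.distrib)
  also have "\<dots> \<le> (\<Sum>u\<in>A. \<Sum>v\<in>A. g u v * w u * w v)"
  proof (intro sum_mono)
    fix u v assume uv: "u \<in> A" "v \<in> A"
    show "\<beta> u * \<gamma> v + \<gamma> u * \<beta> v \<le> g u v * w u * w v"
    proof (cases "f u = f v")
      case True
      then have "\<beta> u * \<gamma> v + \<gamma> u * \<beta> v = 0" by (simp add: \<beta>_def \<gamma>_def)
      then show ?thesis using uv w0 g(1) by simp
    next
      case False
      \<comment> \<open>At most one of \<open>f u\<close> and \<open>f v\<close> equals
        \<open>f p\<close>, so at most one of the two products is nonzero.\<close>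
      have "\<beta> u * \<gamma> v + \<gamma> u * \<beta> v \<le> 1 * (w u * w v)"
        using False uv w0 by (auto simp: \<beta>_def \<gamma>_def)
      also have "\<dots> \<le> g u v * (w u * w v)"
        using False uv w0 g by (intro mult_right_mono) auto
      finally show ?thesis by (simp add: mult_ac)
    qed
  qed
  finally show ?thesis .
qed

section \<open>Range of the distances in a connected graph\<close>

lemma pair_graph_walk_dist:
  fixes G :: "'a pair_pre_digraph"
  assumes "pair_graph G" "Digraph_Component.connected (with_proj G)"
    and "u \<in> pverts G" "v \<in> pverts G"
  obtains p :: "('a \<times> 'a) list" where "graph_dist G u v = real (length p)"
proof -
  interpret pair_graph G by fact
  have "u \<rightarrow>\<^sup>*\<^bsub>with_proj G\<^esub> v"
    using symmetric_connected_imp_strongly_connected[OF pair_sym_arcs assms(2)] assms(3,4)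
    by (auto simp: Digraph_Component.strongly_connected_def)
  from min_cost_awalk[OF this, of "\<lambda>_. 1"] obtain p where
    p: "apath u p v" "\<mu> (\<lambda>_. 1) u v = awalk_cost (\<lambda>_. 1) p" by auto
  have "awalk_cost (\<lambda>_. 1) p = real (length p)" for p :: "('a \<times> 'a) list"
    by (induction p) (auto simp: awalk_cost_def)
  with p(2) have "graph_dist G u v = real (length p)" by (simp add: graph_dist_def)
  then show ?thesis by (rule that)
qed

text \<open>Distances are lengths of walks, hence natural numbers, and the metric axioms exclude 0
  for distinct vertices.\<close>

lemma graph_dist_ge_1:
  fixes G :: "'a pair_pre_digraph"
  assumes "pair_graph G" "Digraph_Component.connected (with_proj G)"
    and "u \<in> pverts G" "v \<in> pverts G" "u \<noteq> v"
  shows "1 \<le> graph_dist G u v"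
proof -
  interpret Metric_space "pverts G" "graph_dist G"
    by (rule Metric_space_graph_dist) fact+
  obtain p :: "('a \<times> 'a) list" where "graph_dist G u v = real (length p)"
    by (rule pair_graph_walk_dist[OF assms(1-4)])
  with zero[of u v] assms(3-5) show ?thesis
    by (cases p) auto
qed

lemma graph_dist_le_diameter:
  assumes "pair_graph G" "u \<in> pverts G" "v \<in> pverts G"
  shows "graph_dist G u v \<le> graph_diameter G"
proof -
  interpret pair_graph G by fact
  have "{graph_dist G u v | u v. u \<in> pverts G \<and> v \<in> pverts G}
      = (\<lambda>(u, v). graph_dist G u v) ` (pverts G \<times> pverts G)" by auto
  moreover have "finite (pverts G)" by (rule pair_finite_verts)
  ultimately show ?thesis
    unfolding graph_diameter_def using assms(2,3) by (intro Max_ge) auto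
qed

section \<open>Rayleigh quotients and the comparison of their infima\<close>

lemma edge_sum_nonneg: "0 \<le> edge_sum G d f"
  unfolding edge_sum_def by (intro divide_nonneg_nonneg sum_nonneg) auto

lemma pair_sum_nonneg: "0 \<le> pair_sum G d f"
  unfolding pair_sum_def by (intro divide_nonneg_nonneg sum_nonneg mult_nonneg_nonneg) auto

lemma rayleigh_nonneg: "0 \<le> rayleigh G d f"
  by (simp add: rayleigh_def edge_sum_nonneg pair_sum_nonneg)

text \<open>The same map serves as a competitor for both graphs. The lower bound of the theorem uses
  this with the two graphs exchanged.\<close>

lemma spectral_gap_le_mult:
  assumes "0 < c" "\<exists>f. f \<in> pverts G \<rightarrow> X \<and> pair_sum G d f \<noteq> 0"
    and "\<And>f. f \<in> pverts G \<rightarrow> X \<Longrightarrow> pair_sum G d f \<noteq> 0 \<Longrightarrow>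
      f \<in> pverts G' \<rightarrow> X \<and> pair_sum G' d f \<noteq> 0 \<and> rayleigh G' d f \<le> c * rayleigh G d f"
  shows "spectral_gap G' X d \<le> c * spectral_gap G X d"
proof -
  \<comment> \<open>Dividing by \<open>c\<close> isolates the infimum over the maps on
    \<open>G\<close>, so it suffices to bound each of its quotients from below. The existence
    assumption keeps that set nonempty.\<close>
  have "spectral_gap G' X d / c \<le> spectral_gap G X d"
    unfolding spectral_gap_def[of G]
  proof (rule cInf_greatest)
    show "{rayleigh G d f |f. f \<in> pverts G \<rightarrow> X \<and> pair_sum G d f \<noteq> 0} \<noteq> {}"
      using assms(2) by auto
    fix r assume "r \<in> {rayleigh G d f |f. f \<in> pverts G \<rightarrow> X \<and> pair_sum G d f \<noteq> 0}"
    then obtain f where f: "f \<in> pverts G \<rightarrow> X" "pair_sum G d f \<noteq> 0" "r = rayleigh G d f"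
      by auto
    have "spectral_gap G' X d \<le> rayleigh G' d f"
      unfolding spectral_gap_def
      using assms(3)[OF f(1,2)] by (intro cInf_lower bdd_belowI[of _ 0]) (auto simp: rayleigh_nonneg)
    with assms(3)[OF f(1,2)] show "spectral_gap G' X d / c \<le> r"
      using \<open>0 < c\<close> f(3) by (simp add: divide_le_eq mult.commute)
  qed
  then show ?thesis using \<open>0 < c\<close> by (simp add: divide_le_eq mult.commute)
qed

section \<open>Degrees and arcs in a connected graph\<close>

lemma out_degree_pair: "out_degree (with_proj G) v = card {w. (v, w) \<in> parcs G}"
proof -
  have "out_arcs (with_proj G) v = Pair v ` {w. (v, w) \<in> parcs G}"
    by (auto simp: out_arcs_def)
  then show ?thesis by (simp add: out_degree_def card_image inj_on_def)
qed

context pair_graph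
begin

text \<open>A walk from \<open>u\<close> to a different vertex has a first arc, and this arc leaves
  \<open>u\<close>.\<close>

lemma out_degree_ge_1:
  assumes "Digraph_Component.connected (with_proj G)" "u \<in> pverts G" "v \<in> pverts G" "u \<noteq> v"
  shows "1 \<le> out_degree (with_proj G) u"
proof -
  have "u \<rightarrow>\<^sup>*\<^bsub>with_proj G\<^esub> v"
    using symmetric_connected_imp_strongly_connected[OF pair_sym_arcs assms(1)] assms(2,3)
    by (auto simp: Digraph_Component.strongly_connected_def)
  then obtain w where "(u, w) \<in> parcs G"
    by (cases rule: converse_reachable_cases) (use \<open>u \<noteq> v\<close> in auto)
  moreover have "finite {w. (u, w) \<in> parcs G}"
    by (rule finite_subset[OF _ finite_imageI[OF pair_finite_arcs, of snd]]) force
  ultimately show ?thesis by (auto simp: out_degree_pair Suc_le_eq card_gt_0_iff)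
qed

text \<open>A map that is constant across every arc is constant along a walk from \<open>u\<close>
  to \<open>v\<close>.\<close>

lemma ex_arc_neq:
  assumes "Digraph_Component.connected (with_proj G)" "u \<in> pverts G" "v \<in> pverts G" "f u \<noteq> f v"
  shows "\<exists>(x, y)\<in>parcs G. f x \<noteq> f y"
proof (rule ccontr)
  assume const: "\<not> ?thesis"
  have "u \<rightarrow>\<^sup>*\<^bsub>with_proj G\<^esub> v"
    using symmetric_connected_imp_strongly_connected[OF pair_sym_arcs assms(1)] assms(2,3)
    by (auto simp: Digraph_Component.strongly_connected_def)
  then have "f u = f v"
    by (induction rule: reachable_induct) (use const in auto)
  with assms(4) show False by simp
qed

end

text \<open>The target graph is abstracted to a metric space whose distances between distinct points
  lie between 1 and \<open>D\<close>; these are the facts about \<open>H\<close> on which both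
  estimates rest.\<close>

locale edge_addition =
  pair_graph G + Metric_space M d
  for G :: "'a pair_pre_digraph" and M :: "'b set" and d :: "'b \<Rightarrow> 'b \<Rightarrow> real" +
  fixes a b :: 'a and D :: real
  assumes conn: "Digraph_Component.connected (with_proj G)"
    and ab: "a \<in> pverts G" "b \<in> pverts G" "a \<noteq> b" "(a, b) \<notin> parcs G"
    and separated: "\<And>x y. x \<in> M \<Longrightarrow> y \<in> M \<Longrightarrow> x \<noteq> y \<Longrightarrow> 1 \<le> d x y"
    and diam: "\<And>x y. x \<in> M \<Longrightarrow> y \<in> M \<Longrightarrow> d x y \<le> D"
begin

abbreviation "G' \<equiv> add_edge G a b"
abbreviation "deg v \<equiv> real (out_degree (with_proj G) v)"

section \<open>Effect of the new edge on degrees, volume and edge sum\<close>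

lemma ba: "(b, a) \<notin> parcs G"
  using ab(4) pair_sym_arcs by (auto simp: symmetric_def elim: symE)

text \<open>Every vertex differs from \<open>a\<close> or from \<open>b\<close>, so the graph
  contains another vertex to which it is connected.\<close>

lemma deg_ge_1: "u \<in> pverts G \<Longrightarrow> 1 \<le> deg u"
  using out_degree_ge_1[OF conn, of u a] out_degree_ge_1[OF conn, of u b] ab by fastforce

lemma sum_deg: "(\<Sum>v\<in>pverts G. deg v) = real (vol G)"
  by (simp add: vol_def)

lemma verts_add_edge [simp]: "pverts G' = pverts G"
  by (simp add: add_edge_def)

text \<open>The increments are kept as two separate \<open>of_bool\<close> terms, the form that
  \<open>weighted_pair_sum_add_point\<close> expects.\<close>

lemma deg_add_edge: "real (out_degree (with_proj G') v) = deg v + of_bool (v = a) + of_bool (v = b)"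
proof -
  have fin: "finite {w. (v, w) \<in> parcs G}"
    by (rule finite_subset[OF _ finite_imageI[OF pair_finite_arcs, of snd]]) force
  have "{w. (v, w) \<in> parcs G'} =
      {w. (v, w) \<in> parcs G} \<union> (if v = a then {b} else if v = b then {a} else {})"
    by (auto simp: add_edge_def)
  with fin ab ba show ?thesis by (auto simp: out_degree_pair)
qed

lemma vol_add_edge: "real (vol G') = real (vol G) + 2"
proof -
  have "real (vol G') = (\<Sum>v\<in>pverts G. deg v + of_bool (v = a) + of_bool (v = b))"
    unfolding vol_def of_nat_sum verts_add_edge deg_add_edge ..
  then show ?thesis
    using ab pair_finite_verts by (simp add: sum.distrib sum_deg of_bool_def)
qed

lemma edge_sum_add_edge: "edge_sum G' d f = edge_sum G d f + (d (f a) (f b))\<^sup>2"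
proof -
  have "parcs G' = insert (a, b) (insert (b, a) (parcs G))"
    by (auto simp: add_edge_def)
  then show ?thesis
    using ab ba pair_finite_arcs by (simp add: edge_sum_def commute[of "f b" "f a"])
qed

section \<open>Growth of the pair sum for a fixed map\<close>

definition row_sum :: "('a \<Rightarrow> 'b) \<Rightarrow> 'a \<Rightarrow> real" where
  "row_sum f x = (\<Sum>v\<in>pverts G. (d (f x) (f v))\<^sup>2 * deg v)"

context
  fixes f :: "'a \<Rightarrow> 'b"
  assumes f: "f \<in> pverts G \<rightarrow> M"
begin

lemma f_mem: "u \<in> pverts G \<Longrightarrow> f u \<in> M"
  using f by auto

lemma pair_sum_add_edge:
  "pair_sum G' d f = pair_sum G d f + row_sum f a + row_sum f b + (d (f a) (f b))\<^sup>2"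
proof -
  let ?g = "\<lambda>u v. (d (f u) (f v))\<^sup>2"
  have sym: "?g u v = ?g v u" for u v by (simp add: commute)
  have diag: "?g u u = 0" if "u \<in> pverts G" for u
    using mdist_zero[OF f_mem[OF that]] by simp
  have "2 * pair_sum G' d f = (\<Sum>u\<in>pverts G. \<Sum>v\<in>pverts G. ?g u v
      * (deg u + of_bool (u = a) + of_bool (u = b)) * (deg v + of_bool (v = a) + of_bool (v = b)))"
    by (simp add: pair_sum_def deg_add_edge)
  \<comment> \<open>The weight of \<open>b\<close> is raised on top of weights in which
    \<open>a\<close> is already raised. The row of \<open>b\<close> therefore contains one extra
    term \<open>?g a b\<close>, the interaction of the two endpoints.\<close>
  also have "\<dots> = (\<Sum>u\<in>pverts G. \<Sum>v\<in>pverts G.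
      ?g u v * (deg u + of_bool (u = a)) * (deg v + of_bool (v = a)))
      + 2 * (\<Sum>v\<in>pverts G. ?g b v * (deg v + of_bool (v = a)))"
    by (rule weighted_pair_sum_add_point) (use pair_finite_verts ab sym diag in auto)
  also have "(\<Sum>u\<in>pverts G. \<Sum>v\<in>pverts G.
      ?g u v * (deg u + of_bool (u = a)) * (deg v + of_bool (v = a)))
      = 2 * pair_sum G d f + 2 * row_sum f a"
    by (subst weighted_pair_sum_add_point)
      (use pair_finite_verts ab sym diag in \<open>auto simp: pair_sum_def row_sum_def\<close>)
  also have "(\<Sum>v\<in>pverts G. ?g b v * (deg v + of_bool (v = a))) = row_sum f b + ?g a b"
    unfolding row_sum_def distrib_left sum.distrib
      sum_mult_of_bool_eq[OF pair_finite_verts ab(1)] sym[of b a] ..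
  finally show ?thesis by simp
qed

lemma row_sum_nonneg: "0 \<le> row_sum f x"
  unfolding row_sum_def by (intro sum_nonneg mult_nonneg_nonneg) auto

lemma row_sum_le_pair_sum:
  assumes "x \<in> pverts G"
  shows "row_sum f x \<le> pair_sum G d f"
proof -
  have "2 * row_sum f x \<le> 2 * pair_sum G d f"
    unfolding row_sum_def pair_sum_def
    using row_sum_le_weighted_pair_sum[of "pverts G" x "\<lambda>u v. (d (f u) (f v))\<^sup>2" deg]
      assms f_mem deg_ge_1 pair_finite_verts
    by (simp add: commute)
  then show ?thesis by simp
qed

text \<open>The left side is bounded by the summand at \<open>v = b\<close>, since \<open>b\<close>
  has degree at least 1.\<close>

lemma dist_sq_le_row_sum: "(d (f a) (f b))\<^sup>2 \<le> row_sum f a"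
proof -
  have "(d (f a) (f b))\<^sup>2 * 1 \<le> (d (f a) (f b))\<^sup>2 * deg b"
    using deg_ge_1 ab by (intro mult_left_mono) auto
  also have "\<dots> \<le> row_sum f a"
    unfolding row_sum_def by (rule member_le_sum) (use ab pair_finite_verts in auto)
  finally show ?thesis by simp
qed

lemma pair_sum_add_edge_le_4: "pair_sum G' d f \<le> 4 * pair_sum G d f"
  using pair_sum_add_edge row_sum_le_pair_sum[OF ab(1)] row_sum_le_pair_sum[OF ab(2)]
    dist_sq_le_row_sum by linarith

lemma pair_sum_le_add_edge: "pair_sum G d f \<le> pair_sum G' d f"
  using pair_sum_add_edge row_sum_nonneg[of a] row_sum_nonneg[of b] by simp

lemma dist_sq_le: "u \<in> pverts G \<Longrightarrow> v \<in> pverts G \<Longrightarrow> (d (f u) (f v))\<^sup>2 \<le> D\<^sup>2"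
  using f_mem diam by (intro power_mono) auto

lemma row_sum_le: "x \<in> pverts G \<Longrightarrow> row_sum f x \<le> D\<^sup>2 * real (vol G)"
  unfolding row_sum_def sum_deg[symmetric] sum_distrib_left
  by (intro sum_mono mult_right_mono dist_sq_le) auto

lemma pair_sum_add_edge_le: "pair_sum G' d f \<le> pair_sum G d f + D\<^sup>2 * (2 * real (vol G) + 1)"
  using pair_sum_add_edge row_sum_le[OF ab(1)] row_sum_le[OF ab(2)] dist_sq_le[OF ab(1,2)]
  by (simp add: algebra_simps)

section \<open>Lower bounds for non-constant maps\<close>

context
  assumes nz: "pair_sum G d f \<noteq> 0"
begin

lemma ex_neq: "\<exists>p\<in>pverts G. \<exists>q\<in>pverts G. f p \<noteq> f q"
proof (rule ccontr)
  assume "\<not> ?thesis"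
  then have eq: "f u = f v" if "u \<in> pverts G" "v \<in> pverts G" for u v
    using that by blast
  have "d (f u) (f v) = 0" if "u \<in> pverts G" "v \<in> pverts G" for u v
    using that eq[OF that] mdist_zero[OF f_mem[OF that(2)]] by simp
  then have "pair_sum G d f = 0"
    unfolding pair_sum_def by (auto intro!: sum.neutral)
  with nz show False by simp
qed

lemma dist_sq_ge_1:
  assumes "u \<in> pverts G" "v \<in> pverts G" "f u \<noteq> f v"
  shows "1 \<le> (d (f u) (f v))\<^sup>2"
  using assms separated[of "f u" "f v"] f_mem by (intro one_le_power) auto

lemma edge_sum_ge_1: "1 \<le> edge_sum G d f"
proof -
  obtain x y where xy: "(x, y) \<in> parcs G" "f x \<noteq> f y"
    using ex_neq ex_arc_neq[OF conn, where f = f] by fastforce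
  then have yx: "(y, x) \<in> parcs G"
    using pair_sym_arcs by (auto simp: symmetric_def elim: symE)
  have verts: "x \<in> pverts G" "y \<in> pverts G"
    using xy(1) by (auto dest: in_arcsD1 in_arcsD2)
  \<comment> \<open>Both arcs of the stretched edge are kept, which compensates for the halving in
    \<open>edge_sum\<close>.\<close>
  have "(\<Sum>(u, v)\<in>{(x, y), (y, x)}. (d (f u) (f v))\<^sup>2)
      \<le> (\<Sum>(u, v)\<in>parcs G. (d (f u) (f v))\<^sup>2)"
    by (rule sum_mono2) (use xy yx pair_finite_arcs in auto)
  moreover have "(\<Sum>(u, v)\<in>{(x, y), (y, x)}. (d (f u) (f v))\<^sup>2) = 2 * (d (f x) (f y))\<^sup>2"
  proof -
    have "x \<noteq> y" using xy(2) by auto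
    then show ?thesis by (simp add: commute[of "f y" "f x"])
  qed
  ultimately show ?thesis
    using dist_sq_ge_1[OF verts xy(2)] by (simp add: edge_sum_def)
qed

lemma pair_sum_ge: "real (vol G) - 1 \<le> pair_sum G d f"
proof -
  obtain p q where "p \<in> pverts G" "q \<in> pverts G" "f p \<noteq> f q" using ex_neq by blast
  from weighted_pair_sum_ge[of "pverts G" p q f "\<lambda>u v. (d (f u) (f v))\<^sup>2" deg] this
  show ?thesis
    using pair_finite_verts dist_sq_ge_1 deg_ge_1 by (simp add: sum_deg pair_sum_def)
qed

lemma pair_sum_pos: "0 < pair_sum G d f"
  using nz pair_sum_nonneg[of G d f] by linarith

end

end

section \<open>Comparison of the Rayleigh quotients of a fixed map\<close>

lemma pair_sum_nonzero_iff:
  assumes "f \<in> pverts G \<rightarrow> M"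
  shows "pair_sum G' d f \<noteq> 0 \<longleftrightarrow> pair_sum G d f \<noteq> 0"
  \<comment> \<open>The new pair sum lies between the old one and four times the old one.\<close>
  using pair_sum_add_edge_le_4[OF assms] pair_sum_le_add_edge[OF assms]
    pair_sum_nonneg[of G d f] by linarith

lemma vol_ge_2: "2 \<le> real (vol G)"
proof -
  have "deg a + deg b = sum deg {a, b}" using ab by simp
  also have "\<dots> \<le> real (vol G)"
    unfolding sum_deg[symmetric] by (rule sum_mono2) (use ab pair_finite_verts in auto)
  finally show ?thesis using deg_ge_1[OF ab(1)] deg_ge_1[OF ab(2)] by linarith
qed

text \<open>The factor \<open>1 + 2 / real (vol G)\<close> is the ratio of the new volume to the old
  one, so it accounts exactly for the change of volume in the quotient.\<close>

lemma vol_ratio_mult_rayleigh: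
  "(1 + 2 / real (vol G)) * rayleigh G d f = (real (vol G) + 2) * edge_sum G d f / pair_sum G d f"
proof -
  have "(1 + 2 / real (vol G)) * real (vol G) = real (vol G) + 2"
    using vol_ge_2 by (simp add: distrib_right)
  then show ?thesis by (simp add: rayleigh_def flip: mult.assoc)
qed

lemma rayleigh_add_edge_le:
  assumes f: "f \<in> pverts G \<rightarrow> M" and nz: "pair_sum G d f \<noteq> 0"
  shows "rayleigh G' d f \<le> (1 + 2 / real (vol G)) * (1 + D\<^sup>2) * rayleigh G d f"
proof -
  let ?E = "edge_sum G d f" and ?P = "pair_sum G d f" and ?V = "real (vol G)"
  have "D\<^sup>2 * 1 \<le> D\<^sup>2 * ?E" using edge_sum_ge_1[OF f nz] by (intro mult_left_mono) auto
  then have E: "edge_sum G' d f \<le> (1 + D\<^sup>2) * ?E"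
    using dist_sq_le[OF f ab(1,2)] by (simp add: edge_sum_add_edge algebra_simps)
  have "rayleigh G' d f \<le> (?V + 2) * ((1 + D\<^sup>2) * ?E) / ?P"
    unfolding rayleigh_def vol_add_edge
    using E pair_sum_le_add_edge[OF f] pair_sum_pos[OF f nz] edge_sum_nonneg[of G' d f]
      edge_sum_nonneg[of G d f]
    by (intro frac_le mult_left_mono) auto
  also have "\<dots> = (1 + 2 / ?V) * (1 + D\<^sup>2) * rayleigh G d f"
    using vol_ratio_mult_rayleigh[of f] by (simp add: mult_ac flip: times_divide_eq_right)
  finally show ?thesis .
qed

text \<open>The nonnegative contribution of the new edge to the edge sum is dropped, and the new
  pair sum is at most the old one divided by \<open>c\<close>. The constant comes from
  \<open>growth_le\<close>.\<close>

lemma rayleigh_add_edge_ge: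
  assumes f: "f \<in> pverts G \<rightarrow> M" and nz: "pair_sum G d f \<noteq> 0"
    and "0 < c" and le: "c * pair_sum G' d f \<le> pair_sum G d f"
  shows "(1 + 2 / real (vol G)) * c * rayleigh G d f \<le> rayleigh G' d f"
proof -
  let ?E = "edge_sum G d f" and ?P = "pair_sum G d f" and ?V = "real (vol G)"
  have pos: "0 < pair_sum G' d f" using pair_sum_pos[OF f nz] pair_sum_le_add_edge[OF f] by linarith
  have "(1 + 2 / ?V) * c * rayleigh G d f = (?V + 2) * ?E / (?P / c)"
    using vol_ratio_mult_rayleigh[of f] by (simp add: mult_ac flip: times_divide_eq_right)
  also have "\<dots> \<le> rayleigh G' d f"
    unfolding rayleigh_def vol_add_edge
    using le \<open>0 < c\<close> pos edge_sum_nonneg[of G d f] edge_sum_nonneg[of G' d f]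
    by (intro frac_le mult_left_mono) (auto simp: edge_sum_add_edge field_simps)
  finally show ?thesis .
qed

text \<open>Each entry of the maximum has its own source: the first is the additive bound on the
  increment, the second the factor 4.\<close>

lemma growth_le:
  assumes f: "f \<in> pverts G \<rightarrow> M" and nz: "pair_sum G d f \<noteq> 0"
  shows "max ((real (vol G) - 1) / (real (vol G) - 1 + D\<^sup>2 * (2 * real (vol G) + 1))) (1 / 4)
    * pair_sum G' d f \<le> pair_sum G d f"
proof -
  define V where "V = real (vol G) - 1"
  define K where "K = D\<^sup>2 * (2 * real (vol G) + 1)"
  have V: "0 < V" and K: "0 \<le> K" using vol_ge_2 by (auto simp: V_def K_def)
  have "V * pair_sum G' d f \<le> V * (pair_sum G d f + K)"
    using pair_sum_add_edge_le[OF f] V by (intro mult_left_mono) (auto simp: K_def)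
  \<comment> \<open>As \<open>V\<close> is at most the old pair sum, the additive error
    \<open>V * K\<close> is absorbed into a multiple of that sum.\<close>
  also have "\<dots> \<le> pair_sum G d f * (V + K)"
    using mult_right_mono[OF pair_sum_ge[OF f nz] K] by (simp add: V_def algebra_simps)
  finally have "V / (V + K) * pair_sum G' d f \<le> pair_sum G d f"
    using V K by (simp add: divide_le_eq)
  with pair_sum_add_edge_le_4[OF f] show ?thesis by (simp add: max_def V_def K_def)
qed

section \<open>Passage to the infimum\<close>

context
  assumes nontrivial: "\<exists>x\<in>M. \<exists>y\<in>M. x \<noteq> y"
begin

lemma ex_pair_sum_nonzero: "\<exists>f. f \<in> pverts G \<rightarrow> M \<and> pair_sum G d f \<noteq> 0"
proof -
  obtain x y where xy: "x \<in> M" "y \<in> M" "x \<noteq> y" using nontrivial by blast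
  \<comment> \<open>Separating \<open>a\<close> from \<open>b\<close> is enough, because their
    squared distance is at most the row sum at \<open>a\<close>, hence at most the pair sum.\<close>
  let ?f = "\<lambda>v. if v = a then x else y"
  have f: "?f \<in> pverts G \<rightarrow> M" using xy by auto
  have "0 < d x y" using separated[OF xy] by simp
  then have "0 < (d (?f a) (?f b))\<^sup>2" using ab by simp
  also have "\<dots> \<le> pair_sum G d ?f"
    using dist_sq_le_row_sum[OF f] row_sum_le_pair_sum[OF f ab(1)] by linarith
  finally show ?thesis using f by (intro exI[of _ ?f]) auto
qed

text \<open>Positivity of each quotient would still allow infimum 0, so a uniform bound is used: the
  numerator is at least 1 and the denominator at most \<open>B\<close>.\<close>

lemma spectral_gap_pos: "0 < spectral_gap G M d"
proof -
  have D: "0 < D" using nontrivial separated diam by fastforce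
  \<comment> \<open>\<open>B\<close> bounds the full sum over ordered pairs, which is twice the pair
    sum: every squared distance is at most \<open>D\<^sup>2\<close>, and the degree products add up
    to the square of the volume.\<close>
  define B where "B = D\<^sup>2 * (real (vol G))\<^sup>2"
  have B: "0 < B" using D vol_ge_2 by (auto simp: B_def)
  have "1 / B \<le> spectral_gap G M d"
    unfolding spectral_gap_def
  proof (rule cInf_greatest)
    show "{rayleigh G d f |f. f \<in> pverts G \<rightarrow> M \<and> pair_sum G d f \<noteq> 0} \<noteq> {}"
      using ex_pair_sum_nonzero by auto
    fix r assume "r \<in> {rayleigh G d f |f. f \<in> pverts G \<rightarrow> M \<and> pair_sum G d f \<noteq> 0}"
    then obtain f where f: "f \<in> pverts G \<rightarrow> M" "pair_sum G d f \<noteq> 0" and r: "r = rayleigh G d f"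
      by auto
    have "2 * pair_sum G d f = (\<Sum>u\<in>pverts G. deg u * row_sum f u)"
      by (simp add: pair_sum_def row_sum_def sum_distrib_left mult_ac)
    also have "\<dots> \<le> (\<Sum>u\<in>pverts G. deg u * (D\<^sup>2 * real (vol G)))"
      by (intro sum_mono mult_left_mono row_sum_le f(1)) auto
    also have "\<dots> = B"
      unfolding sum_distrib_right[symmetric] sum_deg B_def power2_eq_square by simp
    finally have "pair_sum G d f \<le> B" using pair_sum_nonneg[of G d f] by linarith
    moreover have "1 * 1 \<le> real (vol G) * edge_sum G d f"
      using vol_ge_2 edge_sum_ge_1[OF f] by (intro mult_mono) auto
    ultimately show "1 / B \<le> r"
      unfolding r rayleigh_def using pair_sum_pos[OF f] by (intro frac_le) auto
  qed
  with B show ?thesis by (smt (verit) divide_pos_pos)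
qed

lemma spectral_gap_add_edge_le:
  "spectral_gap G' M d \<le> (1 + 2 / real (vol G)) * (1 + D\<^sup>2) * spectral_gap G M d"
  using vol_ge_2 ex_pair_sum_nonzero rayleigh_add_edge_le
  by (intro spectral_gap_le_mult) (auto simp: pair_sum_nonzero_iff intro!: mult_pos_pos add_pos_nonneg)

lemma spectral_gap_add_edge_ge:
  "(1 + 2 / real (vol G)) *
      max ((real (vol G) - 1) / (real (vol G) - 1 + D\<^sup>2 * (2 * real (vol G) + 1))) (1 / 4)
    * spectral_gap G M d \<le> spectral_gap G' M d" (is "?c * ?m * _ \<le> _")
proof -
  \<comment> \<open>The entry \<open>1 / 4\<close> already makes the maximum positive.\<close>
  have m: "0 < ?m" by (simp add: less_max_iff_disj)
  have c: "0 < ?c" using vol_ge_2 by (auto intro!: add_pos_nonneg)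
  have cm: "0 < ?c * ?m" using c m by (rule mult_pos_pos)
  \<comment> \<open>The roles of the graphs are exchanged: the old gap is bounded above by a
    multiple of the new one.\<close>
  have "spectral_gap G M d \<le> (1 / (?c * ?m)) * spectral_gap G' M d"
  proof (rule spectral_gap_le_mult)
    show "0 < 1 / (?c * ?m)" using cm by simp
    show "\<exists>f. f \<in> pverts G' \<rightarrow> M \<and> pair_sum G' d f \<noteq> 0"
      using ex_pair_sum_nonzero pair_sum_nonzero_iff by auto
    fix f assume f: "f \<in> pverts G' \<rightarrow> M" "pair_sum G' d f \<noteq> 0"
    then have f': "f \<in> pverts G \<rightarrow> M" "pair_sum G d f \<noteq> 0"
      using pair_sum_nonzero_iff by auto
    have "?c * ?m * rayleigh G d f \<le> rayleigh G' d f"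
      by (rule rayleigh_add_edge_ge[OF f' m growth_le[OF f']])
    then have "rayleigh G d f \<le> rayleigh G' d f / (?c * ?m)"
      by (subst pos_le_divide_eq[OF cm]) (simp only: mult_ac)
    then show "f \<in> pverts G \<rightarrow> M \<and> pair_sum G d f \<noteq> 0 \<and>
        rayleigh G d f \<le> 1 / (?c * ?m) * rayleigh G' d f"
      using f' by simp
  qed
  then have "spectral_gap G M d \<le> spectral_gap G' M d / (?c * ?m)" by simp
  then show ?thesis by (subst (asm) pos_le_divide_eq[OF cm]) (simp only: mult_ac)
qed

end

end

section \<open>Specialisation of the target space to the graph \<open>H\<close>\<close>

theorem theorem6p1:
  fixes G G' :: "'a pair_pre_digraph" and H :: "'b pair_pre_digraph"
    and a b :: 'a and k :: nat and D\<^sub>H :: real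
  assumes "pair_graph G" and "Digraph_Component.connected (with_proj G)"
    and "vol G \<ge> 6"
    and "a \<in> pverts G" and "b \<in> pverts G" and "a \<noteq> b" and "(a, b) \<notin> parcs G"
    and "G' = add_edge G a b"
    and "pair_graph H" and "Digraph_Component.connected (with_proj H)"
    and "D\<^sub>H = graph_diameter H"
    and "card (pverts H) = k" and "k \<ge> 2"
  shows "graph_spectral_gap G' H / graph_spectral_gap G H
           \<le> (1 + 2 / real (vol G)) * (1 + D\<^sub>H\<^sup>2) \<and>
         graph_spectral_gap G' H / graph_spectral_gap G H
           \<ge> (1 + 2 / real (vol G)) *
              max ((real (vol G) - 1) / (real (vol G) - 1 + D\<^sub>H\<^sup>2 * (2 * real (vol G) + 1))) (1 / 4)"
proof -
  interpret edge_addition G "pverts H" "graph_dist H" a b D\<^sub>H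
    using assms graph_dist_ge_1[of H] graph_dist_le_diameter[of H]
    by (intro edge_addition.intro Metric_space_graph_dist edge_addition_axioms.intro) auto
  have nontrivial: "\<exists>x\<in>pverts H. \<exists>y\<in>pverts H. x \<noteq> y"
    using assms(12,13) card_le_Suc0_iff_eq[of "pverts H"] card.infinite[of "pverts H"]
    by (metis not_less_eq_eq le_zero_eq numeral_2_eq_2 nat.distinct(1))
  \<comment> \<open>Positivity of the gap of \<open>G\<close> allows both quotients to be cleared of
    their denominator.\<close>
  show ?thesis
    unfolding graph_spectral_gap_def assms(8)
      pos_divide_le_eq[OF spectral_gap_pos[OF nontrivial]]
      pos_le_divide_eq[OF spectral_gap_pos[OF nontrivial]]
    using spectral_gap_add_edge_le[OF nontrivial] spectral_gap_add_edge_ge[OF nontrivial] by blast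
qed

end
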